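(* Let $n>1$ be an odd integer, and let $A$ be the subgroup of $\Phi(2n)$ generated by $n+2$, or any one of the cosets of this subgroup in $\Phi(2n)$. Then $$\prod_{x\in A}\Gamma\left(\frac{x}{2n}\right)=2^{b(A)}\,\pi^{\nu(n)/2}.$$
   Context: For an odd integer $n>1$, $\Phi(2n)$ denotes the set of integers in the interval $[0,2n]$ that are relatively prime to $2n$; it is a group under multiplication modulo $2n$. The number $\nu(n)$ is the order of the subgroup of $\Phi(2n)$ generated by $n+2$. For a subset $A\subseteq\Phi(2n)$, $b(A)$ is the number of elements $x\in A$ (regarded as integers in $[0,2n]$) with $x>n$. $\Gamma$ is the Euler gamma function. *)

theory Defs
  imports
    "HOL-Analysis.Gamma_Function"
    "HOL-Algebra.Coset"
    "HOL-Algebra.Generated_Groups"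
    "HOL-Number_Theory.Cong"
begin

definition Phi :: "nat \<Rightarrow> nat monoid" where
  "Phi m = \<lparr>carrier = {x. x \<in> {0..m} \<and> coprime x m},
            monoid.mult = (\<lambda>x y. x * y mod m),
            one = 1\<rparr>"

lemma comm_group_Phi:
  assumes "1 < m"
  shows "comm_group (Phi m)"
proof (rule comm_groupI)
  fix x y assume "x \<in> carrier (Phi m)" "y \<in> carrier (Phi m)"
  then have "coprime (x * y mod m) m"
    using assms by (simp add: Phi_def)
  then show "x \<otimes>\<^bsub>Phi m\<^esub> y \<in> carrier (Phi m)"
    using assms by (simp add: Phi_def less_imp_le)
next
  show "\<one>\<^bsub>Phi m\<^esub> \<in> carrier (Phi m)"
    using assms by (simp add: Phi_def)
next
  fix x y z
  show "x \<otimes>\<^bsub>Phi m\<^esub> y \<otimes>\<^bsub>Phi m\<^esub> z = x \<otimes>\<^bsub>Phi m\<^esub> (y \<otimes>\<^bsub>Phi m\<^esub> z)"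
    by (simp add: Phi_def mod_simps mult.assoc)
next
  fix x y
  show "x \<otimes>\<^bsub>Phi m\<^esub> y = y \<otimes>\<^bsub>Phi m\<^esub> x"
    by (simp add: Phi_def mult.commute)
next
  fix x assume x: "x \<in> carrier (Phi m)"
  then have "x \<noteq> m"
    using assms by (auto simp: Phi_def)
  with x show "\<one>\<^bsub>Phi m\<^esub> \<otimes>\<^bsub>Phi m\<^esub> x = x"
    by (simp add: Phi_def)
next
  fix x assume "x \<in> carrier (Phi m)"
  then have x: "coprime x m"
    by (simp add: Phi_def)
  then obtain y where y: "[x * y = 1] (mod m)"
    using cong_solve_coprime_nat by auto
  then have "[x * (y mod m) = 1] (mod m)"
    by (simp add: cong_def mod_mult_right_eq)
  moreover from this have "coprime (x * (y mod m)) m"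
    by (rule cong_imp_coprime[OF cong_sym]) simp
  moreover have "y mod m \<le> m"
    using assms by (simp add: less_imp_le)
  ultimately show "\<exists>z\<in>carrier (Phi m). z \<otimes>\<^bsub>Phi m\<^esub> x = \<one>\<^bsub>Phi m\<^esub>"
    using assms
    by (intro bexI[of _ "y mod m"]) (auto simp: Phi_def cong_def mult.commute)
qed

lemma generator_in_Phi:
  assumes "odd n" "1 < n"
  shows "n + 2 \<in> carrier (Phi (2 * n))"
proof -
  have "coprime n 2" using assms(1) by simp
  then have "coprime (n + 2) n"
    using gcd_add2[of n 2] by (metis coprime_commute coprime_iff_gcd_eq_1)
  moreover have "coprime (n + 2) 2"
    using assms(1) by simp
  ultimately have "coprime (n + 2) (2 * n)"
    by (simp only: coprime_mult_right_iff simp_thms)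
  then show ?thesis using assms by (simp add: Phi_def)
qed

definition genPhi :: "nat \<Rightarrow> nat set" where
  "genPhi n = generate (Phi (2 * n)) {n + 2}"

definition nu :: "nat \<Rightarrow> nat" where
  "nu n = card (genPhi n)"

definition b_num :: "nat \<Rightarrow> nat set \<Rightarrow> nat" where
  "b_num n A = card {x \<in> A. n < x}"

end

theory Submission
  imports Defs
begin

text \<open>
  Write \<open>T x = x (n + 2) mod 2n\<close>. A coset \<open>A\<close> of the subgroup generated by \<open>n + 2\<close> is a finite set of
  odd numbers that \<open>T\<close> permutes. For odd \<open>x\<close> we have \<open>T x \<equiv> 2 x + n\<close>, so the half-turn
  \<open>S x = (x + n) mod 2n\<close> satisfies \<open>S (T x) = 2 x mod 2n\<close>. Hence the three numbers
  \<open>x\<close>, \<open>S x\<close>, \<open>S (T x)\<close>, divided by \<open>2n\<close>, are exactly the arguments of Legendre's duplication formula: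
  with \<open>G x = \<Gamma>(x / 2n)\<close> it reads
  \<open>G x * G (S x) = 2 powr (1 - x / n + [x > n]) * sqrt \<pi> * G (S (T x))\<close>,
  where the bracket is 1 or 0 and accounts for the reductions modulo \<open>2n\<close>.
  In the product over \<open>A\<close> the factors \<open>G (S x)\<close> and \<open>G (S (T x))\<close> cancel, since \<open>T\<close> permutes \<open>A\<close>,
  which leaves an explicit power of 2 times a power of \<open>\<pi>\<close>.

  The exponent of 2 is \<open>b(A)\<close> because the elements of \<open>A\<close> have mean \<open>n\<close>. This follows
  from the same cancellation, applied to \<open>S\<close> in place of \<open>G \<circ> S\<close>:
  \<open>S (T x) - S x = x - n\<close> exactly, as both reductions subtract \<open>2n\<close> precisely when \<open>x > n\<close>.
\<close>

text \<open>The numbers \<open>z\<close> and \<open>z + 1/2\<close> in the duplication formula are the smaller and the larger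
  of \<open>x / 2n\<close> and its half-turn, so which of the two is \<open>x / 2n\<close> depends on whether \<open>x > n\<close>.\<close>

lemma Gamma_duplication_mod:
  fixes n x :: nat
  assumes "0 < x" "x < 2 * n" "x \<noteq> n"
  shows "Gamma (real x / (2 * real n)) * Gamma (real ((x + n) mod (2 * n)) / (2 * real n)) =
         (2 powr (1 - real x / real n + of_bool (n < x)) * sqrt pi) *
           Gamma (real (2 * x mod (2 * n)) / (2 * real n))"
proof -
  have n: "n > 0" using assms by simp
  have legendre: "Gamma z * Gamma (z + 1/2) = 2 powr (1 - 2 * z) * sqrt pi * Gamma (2 * z)"
    if "z > 0" for z :: real
  proof -
    have "complex_of_real z \<notin> \<int>\<^sub>\<le>\<^sub>0" "complex_of_real z + 1/2 \<notin> \<int>\<^sub>\<le>\<^sub>0"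
      using that by (auto elim!: nonpos_Ints_cases simp: complex_eq_iff)
    then have "Gamma (complex_of_real z) * Gamma (complex_of_real z + 1/2) =
        exp ((1 - 2 * complex_of_real z) * of_real (ln 2)) * of_real (sqrt pi) *
          Gamma (2 * complex_of_real z)"
      by (rule Gamma_legendre_duplication)
    also have "complex_of_real z + 1/2 = of_real (z + 1/2)" by simp
    also have "(1 - 2 * complex_of_real z) * of_real (ln 2) = of_real ((1 - 2 * z) * ln 2)" by simp
    also have "2 * complex_of_real z = of_real (2 * z)" by simp
    finally have "Gamma z * Gamma (z + 1/2) = exp ((1 - 2 * z) * ln 2) * sqrt pi * Gamma (2 * z)"
      unfolding Gamma_complex_of_real exp_of_real of_real_mult[symmetric] of_real_eq_iff .
    then show ?thesis by (simp add: powr_def)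
  qed
  show ?thesis
  proof (cases "n < x")
    case True
    have "(x + n) mod (2 * n) = x - n"
      using True assms by (simp add: mod_if)
    moreover have "2 * x mod (2 * n) = 2 * (x - n)"
      using True assms by (simp add: mod_if diff_mult_distrib2)
    moreover have "real (x - n) / (2 * real n) + 1/2 = real x / (2 * real n)"
      "1 - 2 * (real (x - n) / (2 * real n)) = 1 - real x / real n + of_bool (n < x)"
      "2 * (real (x - n) / (2 * real n)) = real (2 * (x - n)) / (2 * real n)"
      using True n by (simp_all add: of_nat_diff field_simps)
    moreover have "real (x - n) / (2 * real n) > 0"
      using True n by simp
    ultimately show ?thesis
      using legendre[of "real (x - n) / (2 * real n)"] by (simp only: mult.commute)
  next
    case False
    then have "x < n" using assms by simp
    then show ?thesis
      using legendre[of "real x / (2 * real n)"] assms n by (simp add: field_simps)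
  qed
qed

lemma half_turn_generator_mult:
  fixes n x :: nat
  assumes "odd x"
  shows "(x * (n + 2) mod (2 * n) + n) mod (2 * n) = 2 * x mod (2 * n)"
proof -
  obtain k where k: "x = 2 * k + 1" using assms oddE by blast
  have "x * (n + 2) + n = 2 * x + (k + 1) * (2 * n)"
    by (simp add: k algebra_simps)
  then show ?thesis
    by (metis mod_add_left_eq mod_mult_self1)
qed

text \<open>All that the evaluation needs from the group structure is that multiplication by \<open>n + 2\<close>
  permutes \<open>A\<close>. The residues \<open>0\<close> and \<open>n\<close> are excluded because there \<open>x / 2n\<close> or its half-turn
  is a pole of \<open>\<Gamma>\<close>.\<close>

context
  fixes n :: nat and A :: "nat set"
  assumes fin: "finite A"
    and odd: "\<And>x. x \<in> A \<Longrightarrow> odd x"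
    and range: "\<And>x. x \<in> A \<Longrightarrow> 0 < x \<and> x < 2 * n \<and> x \<noteq> n"
    and perm: "bij_betw (\<lambda>x. x * (n + 2) mod (2 * n)) A A"
begin

lemma sum_eq_mean: "(\<Sum>x\<in>A. real x) = real n * real (card A)"
proof -
  have step: "real (2 * x mod (2 * n)) = real ((x + n) mod (2 * n)) + real x - real n"
    if "x \<in> A" for x
  proof (cases "n < x")
    case True
    then have "(x + n) mod (2 * n) = x - n" "2 * x mod (2 * n) = 2 * x - 2 * n"
      using range[OF that] by (simp_all add: le_mod_geq)
    then show ?thesis using True by (simp add: of_nat_diff)
  next
    case False
    then show ?thesis using range[OF that] by simp
  qed
  have "(\<Sum>x\<in>A. real ((x + n) mod (2 * n))) =
        (\<Sum>x\<in>A. real ((x * (n + 2) mod (2 * n) + n) mod (2 * n)))"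
    by (rule sum.reindex_bij_betw[OF perm, symmetric])
  also have "\<dots> = (\<Sum>x\<in>A. real ((x + n) mod (2 * n)) + real x - real n)"
    by (intro sum.cong refl) (simp only: half_turn_generator_mult[OF odd] step)
  finally show ?thesis
    by (simp add: sum.distrib sum_subtractf)
qed

lemma prod_Gamma_eq:
  "(\<Prod>x\<in>A. Gamma (real x / (2 * real n))) = 2 ^ b_num n A * pi powr (real (card A) / 2)"
proof (cases "A = {}")
  case True
  then show ?thesis by (simp add: b_num_def)
next
  case False
  then have n: "n > 0" using range by fastforce
  define c where "c x = 2 powr (1 - real x / real n + of_bool (n < x)) * sqrt pi" for x
  define E where "E x = Gamma (real ((x + n) mod (2 * n)) / (2 * real n))" for x
  have "E x > 0" if "x \<in> A" for x
  proof -
    have "(x + n) mod (2 * n) > 0"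
      using range[OF that] by (cases "n < x") (simp_all add: mod_if)
    then show ?thesis using n by (simp add: E_def Gamma_real_pos)
  qed
  then have E_nz: "prod E A \<noteq> 0"
    using fin by (force simp: prod_zero_iff)
  have "(\<Prod>x\<in>A. Gamma (real x / (2 * real n))) * prod E A =
        (\<Prod>x\<in>A. c x * E (x * (n + 2) mod (2 * n)))"
    unfolding prod.distrib[symmetric] E_def c_def
    by (intro prod.cong refl)
       (simp only: half_turn_generator_mult[OF odd] Gamma_duplication_mod range
          simp_thms not_False_eq_True)
  also have "\<dots> = prod c A * prod E A"
    by (simp only: prod.distrib prod.reindex_bij_betw[OF perm, of E])
  finally have "(\<Prod>x\<in>A. Gamma (real x / (2 * real n))) = prod c A"
    using E_nz by simp
  also have "\<dots> = 2 powr (\<Sum>x\<in>A. 1 - real x / real n + of_bool (n < x)) * sqrt pi ^ card A"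
    by (simp add: c_def prod.distrib powr_sum)
  also have "(\<Sum>x\<in>A. 1 - real x / real n + of_bool (n < x)) = real (b_num n A)"
  proof -
    have "(\<Sum>x\<in>A. of_bool (n < x)) = real (b_num n A)"
      using fin by (simp add: b_num_def Int_def)
    then show ?thesis
      using n by (simp add: sum.distrib sum_subtractf sum_eq_mean flip: sum_divide_distrib)
  qed
  also have "sqrt pi ^ card A = pi powr (real (card A) / 2)"
    by (simp add: powr_half_sqrt[symmetric] powr_powr flip: powr_realpow)
  finally show ?thesis by (simp add: powr_realpow)
qed

end

text \<open>An injective self-map of a finite set is a permutation, so it suffices that a right coset
  of the subgroup is closed under multiplication by the subgroup's elements on the right, which
  is where commutativity enters.\<close>

lemma (in comm_group) bij_betw_mult_rcoset:
  assumes H: "subgroup H G" and A: "A \<in> rcosets H" and h: "h \<in> H" and fin: "finite A"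
  shows "bij_betw (\<lambda>x. x \<otimes> h) A A"
proof -
  obtain a where a: "a \<in> carrier G" and A_eq: "A = H #> a"
    using A by (auto simp: RCOSETS_def)
  have H_carrier: "H \<subseteq> carrier G" by (rule subgroup.subset[OF H])
  have sub: "A \<subseteq> carrier G"
    unfolding A_eq by (rule r_coset_subset_G[OF H_carrier a])
  have inj: "inj_on (\<lambda>x. x \<otimes> h) A"
    using sub h H_carrier by (intro inj_onI) (auto simp: subset_eq)
  have "x \<otimes> h \<in> A" if x: "x \<in> A" for x
  proof -
    obtain g where g: "g \<in> H" "x = g \<otimes> a"
      using x by (auto simp: A_eq r_coset_def)
    then have "x \<otimes> h = (g \<otimes> h) \<otimes> a"
      using a h H_carrier by (simp add: m_ac subset_eq)
    then show ?thesis
      using subgroup.m_closed[OF H g(1) h] by (auto simp: A_eq r_coset_def)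
  qed
  then have "(\<lambda>x. x \<otimes> h) ` A = A"
    using endo_inj_surj[OF fin _ inj] by blast
  with inj show ?thesis by (simp add: bij_betw_def)
qed

theorem mainTheorem1:
  fixes n :: nat and A :: "nat set"
  assumes "odd n" and "n > 1"
    and "A = genPhi n \<or> A \<in> rcosets\<^bsub>Phi (2 * n)\<^esub> (genPhi n)"
  shows "(\<Prod>x\<in>A. Gamma (real x / (2 * real n))) = 2 ^ b_num n A * pi powr (real (nu n) / 2)"
proof -
  let ?G = "Phi (2 * n)"
  interpret comm_group ?G
    using assms by (intro comm_group_Phi) simp
  have gen: "{n + 2} \<subseteq> carrier ?G"
    using generator_in_Phi assms by simp
  have H: "subgroup (genPhi n) ?G"
    unfolding genPhi_def by (rule generate_is_subgroup[OF gen])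
  have coset: "A \<in> rcosets\<^bsub>?G\<^esub> (genPhi n)"
    using assms(3) subgroup.subgroup_in_rcosets[OF H is_group] by auto
  have sub: "A \<subseteq> carrier ?G"
    using rcosets_part_G[OF H] coset by auto
  have fin_G: "finite (carrier ?G)"
    by (rule finite_subset[of _ "{0..2 * n}"]) (auto simp: Phi_def)
  have fin: "finite A"
    by (rule finite_subset[OF sub fin_G])
  have "n + 2 \<in> genPhi n"
    unfolding genPhi_def by (simp add: generate.incl)
  from bij_betw_mult_rcoset[OF H coset this fin]
  have perm: "bij_betw (\<lambda>x. x * (n + 2) mod (2 * n)) A A"
    by (simp add: Phi_def)
  have odd: "odd x" if "x \<in> A" for x
    using sub that by (auto simp: Phi_def)
  have range: "0 < x \<and> x < 2 * n \<and> x \<noteq> n" if "x \<in> A" for x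
  proof -
    have "x \<le> 2 * n" and cop: "coprime x (2 * n)"
      using sub that by (auto simp: Phi_def)
    moreover have "x \<noteq> 0" "x \<noteq> 2 * n" "x \<noteq> n"
      using cop assms(2) by (auto intro!: Nat.gr0I)
    ultimately show ?thesis by simp
  qed
  have "card A = nu n"
    unfolding nu_def
    using card_rcosets_equal[OF coset subgroup.subset[OF H]] by simp
  then show ?thesis
    using prod_Gamma_eq[OF fin odd range perm] by simp
qed

end
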